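(* Let $(\Phi,\mathfrak N,\mathfrak T,\mathfrak R,\mathfrak S,\phi_{\mathrm{start}},\Sigma,\mathrm{Lex},\mathrm{Sel})$ be a parameterized local lexing, $D\in\Sigma^*$, and let $x=(r,d,i,j,\rho)$ be a parameterized item with $r=N_{f_{v+1}}\to X_1^{f_1}\cdots X_v^{f_v}$ and $v\ge d+1$. Then for each $\gamma\in\Phi$ there exist $\beta\in\Phi$ and a string $w$ over $\overline{\mathfrak N}\cup\overline{\mathfrak T}$ such that $$\big(N^{\rho_0}_\beta\to(X_1)^{\rho_1}_{\rho_2}\cdots(X_d)^{\rho_{2d-1}}_{\rho_{2d}}\bullet(X_{d+1})^{\rho_{2d+1}}_{\gamma}\,w,\ i,\ j\big)\in\overline x .$$
   Context: $\Phi$ is a non-empty set; $\mathfrak N,\mathfrak T$ disjoint sets of nonterminals and terminals; $\mathfrak S\in\mathfrak N$, $\phi_{\mathrm{start}}\in\Phi$; $\mathfrak R$ a set of parameterized rules $N_{f_{k+1}}\to X_1^{f_1}\cdots X_k^{f_k}$ ($k\ge0$, $N\in\mathfrak N$, $X_i\in\mathfrak N\cup\mathfrak T$, partial $f_i:\Phi^{2i-1}\rightharpoonup\Phi$); $\Sigma,\mathrm{Lex},\mathrm{Sel}$ not needed here. Sequences are indexed from 0; $\mathrm{take}_n$ takes the first $n$ entries. $\langle f_1,\dots,f_u\rangle$ is the set of $\rho\in\Phi^{2u}$ with $f_i$ defined at $(\rho_0,\dots,\rho_{2i-2})$ and $\rho_{2i-1}=f_i(\rho_0,\dots,\rho_{2i-2})$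 for $i=1,\dots,u$. Induced grammar: nonterminals $\overline{\mathfrak N}=(\mathfrak N\times\Phi\times\Phi)\cup\{\top,\bot\}$, terminals $\overline{\mathfrak T}=\mathfrak T\times\Phi\times\Phi$, triples $(X,\alpha,\beta)$ written $X^\alpha_\beta$. For each $r=N_{f_{k+1}}\to X_1^{f_1}\cdots X_k^{f_k}\in\mathfrak R$ the set $\overline r$ consists of (i) rules $N^\alpha_\beta\to(X_1)^{\alpha_1}_{\beta_1}\cdots(X_k)^{\alpha_k}_{\beta_k}$ with $(\alpha,\alpha_1,\beta_1,\dots,\alpha_k,\beta_k,\beta)\in\langle f_1,\dots,f_{k+1}\rangle$, and (ii) rules $N^\alpha_\beta\to(X_1)^{\alpha_1}_{\beta_1}\cdots(X_h)^{\alpha_h}_{\beta_h}\bot$ with $1\le h\le k$, $\beta,\beta_h\in\Phi$, $(\alpha,\alpha_1,\beta_1,\dots,\alpha_h)\in\langle f_1,\dots,f_h\rangle$ and $f_{h+1}$ undefined at $(\alpha,\alpha_1,\beta_1,\dots,\alpha_h,\beta_h)$. A parameterized item is $(r,d,i,j,\rho)$ with $r\in\mathfrak R$ having $k$ right-hand symbols, $0\le d\le k$, $0\le i\le j\le|D|$, $\rho\in\langle f_1,\dots,f_{d+1}\rangle$. An ordinary item $(q,d,i,j)$ ($q=(L\to w)$ an induced rule, $0\le d\le|w|$) is written $(L\to w_1\bullet w_2,i,j)$ with $|w_1|=d$. For $x=(r,d,i,j,\rho)$, $\overline x$ consists of all $(q,d,i,j)$ with $q\in\overline r$ of type (i) and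 $\mathrm{take}_{2(d+1)}(\alpha,\alpha_1,\beta_1,\dots,\alpha_k,\beta_k,\beta)=\rho$, and all $(q,d,i,j)$ with $q\in\overline r$ of type (ii), $d\le h-1$, and $\mathrm{take}_{2(d+1)}(\alpha,\alpha_1,\beta_1,\dots,\alpha_h)=\rho$. *)

theory Defs
  imports Main
begin

text \<open>
  A parameterized rule \<open>N\<^bsub>f\<^sub>k\<^sub>+\<^sub>1\<^esub> \<rightarrow> X\<^sub>1\<^bsup>f\<^sub>1\<^esup> \<dots> X\<^sub>k\<^bsup>f\<^sub>k\<^esup>\<close> is stored as \<open>PRule N [X\<^sub>1, \<dots>, X\<^sub>k] [f\<^sub>1, \<dots>, f\<^sub>k\<^sub>+\<^sub>1]\<close>,
  so \<open>X\<^sub>i = rhs r ! (i - 1)\<close> and \<open>f\<^sub>i = funs r ! (i - 1)\<close>. A partial function from tuples is a map on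
  lists; \<open>partial_fun \<Phi> n\<close> confines it to arguments in \<open>\<Phi>\<^sup>n\<close> and values in \<open>\<Phi>\<close>.
\<close>

datatype ('s, 'p) prule =
  PRule (lhs: 's) (rhs: "'s list") (funs: "('p list \<rightharpoonup> 'p) list")

definition partial_fun :: "'p set \<Rightarrow> nat \<Rightarrow> ('p list \<rightharpoonup> 'p) \<Rightarrow> bool" where
  "partial_fun \<Phi> n f \<longleftrightarrow> dom f \<subseteq> {\<rho>. length \<rho> = n \<and> set \<rho> \<subseteq> \<Phi>} \<and> ran f \<subseteq> \<Phi>"

definition prule_over :: "'p set \<Rightarrow> 's set \<Rightarrow> 's set \<Rightarrow> ('s, 'p) prule \<Rightarrow> bool" where
  "prule_over \<Phi> \<NN> \<TT> r \<longleftrightarrow>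
     lhs r \<in> \<NN> \<and> set (rhs r) \<subseteq> \<NN> \<union> \<TT> \<and>
     length (funs r) = length (rhs r) + 1 \<and>
     (\<forall>i \<in> {1..length (rhs r) + 1}. partial_fun \<Phi> (2 * i - 1) (funs r ! (i - 1)))"

text \<open>
  The grammar part of a parameterized local lexing. The lexer and the selector play no role in
  parameterized items and the sets of ordinary items they represent, so nothing is assumed of them.
\<close>

definition parameterized_grammar ::
  "'p set \<Rightarrow> 's set \<Rightarrow> 's set \<Rightarrow> ('s, 'p) prule set \<Rightarrow> 's \<Rightarrow> 'p \<Rightarrow> bool" where
  "parameterized_grammar \<Phi> \<NN> \<TT> \<RR> \<SS> \<phi>start \<longleftrightarrow>
     \<Phi> \<noteq> {} \<and> \<NN> \<inter> \<TT> = {} \<and> \<SS> \<in> \<NN> \<and> \<phi>start \<in> \<Phi> \<and> (\<forall>r \<in> \<RR>. prule_over \<Phi> \<NN> \<TT> r)"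

text \<open>The set \<open>\<langle>f\<^sub>1, \<dots>, f\<^sub>u\<rangle> \<subseteq> \<Phi>\<^sup>2\<^sup>u\<close>.\<close>

definition traces :: "'p set \<Rightarrow> ('p list \<rightharpoonup> 'p) list \<Rightarrow> 'p list set" where
  "traces \<Phi> fs =
     {\<rho>. length \<rho> = 2 * length fs \<and> set \<rho> \<subseteq> \<Phi> \<and>
        (\<forall>i \<in> {1..length fs}. (fs ! (i - 1)) (take (2 * i - 1) \<rho>) = Some (\<rho> ! (2 * i - 1)))}"

text \<open>\<open>Par X \<alpha> \<beta>\<close> is \<open>X\<close> with superscript \<open>\<alpha>\<close> and subscript \<open>\<beta>\<close>.\<close>

datatype ('s, 'p) isym = Top | Bot | Par 's 'p 'p

definition induced_nonterminals :: "'p set \<Rightarrow> 's set \<Rightarrow> ('s, 'p) isym set" where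
  "induced_nonterminals \<Phi> \<NN> = {Par X \<alpha> \<beta> | X \<alpha> \<beta>. X \<in> \<NN> \<and> \<alpha> \<in> \<Phi> \<and> \<beta> \<in> \<Phi>} \<union> {Top, Bot}"

definition induced_terminals :: "'p set \<Rightarrow> 's set \<Rightarrow> ('s, 'p) isym set" where
  "induced_terminals \<Phi> \<TT> = {Par X \<alpha> \<beta> | X \<alpha> \<beta>. X \<in> \<TT> \<and> \<alpha> \<in> \<Phi> \<and> \<beta> \<in> \<Phi>}"

type_synonym ('s, 'p) irule = "('s, 'p) isym \<times> ('s, 'p) isym list"

text \<open>
  For \<open>\<sigma> = (\<alpha>, \<alpha>\<^sub>1, \<beta>\<^sub>1, \<alpha>\<^sub>2, \<beta>\<^sub>2, \<dots>)\<close> we have \<open>\<alpha>\<^sub>m = \<sigma> ! (2 * m - 1)\<close> and \<open>\<beta>\<^sub>m = \<sigma> ! (2 * m)\<close>;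
  \<open>decorate Xs \<sigma> n\<close> is the string of the first \<open>n\<close> symbols \<open>X\<^sub>m\<close> with superscript \<open>\<alpha>\<^sub>m\<close> and
  subscript \<open>\<beta>\<^sub>m\<close>.
\<close>

definition decorate :: "'s list \<Rightarrow> 'p list \<Rightarrow> nat \<Rightarrow> ('s, 'p) isym list" where
  "decorate Xs \<sigma> n = map (\<lambda>m. Par (Xs ! (m - 1)) (\<sigma> ! (2 * m - 1)) (\<sigma> ! (2 * m))) [1..<n + 1]"

text \<open>
  The two kinds of rules induced by \<open>r\<close>, each together with the tuple it arises from:
  \<open>\<sigma> = (\<alpha>, \<alpha>\<^sub>1, \<beta>\<^sub>1, \<dots>, \<alpha>\<^sub>k, \<beta>\<^sub>k, \<beta>)\<close> for the complete rules, and \<open>\<sigma> = (\<alpha>, \<alpha>\<^sub>1, \<beta>\<^sub>1, \<dots>, \<alpha>\<^sub>h)\<close> for the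
  rules ending in \<open>Bot\<close>.
\<close>

definition complete_rule :: "'p set \<Rightarrow> ('s, 'p) prule \<Rightarrow> 'p list \<Rightarrow> ('s, 'p) irule \<Rightarrow> bool" where
  "complete_rule \<Phi> r \<sigma> q \<longleftrightarrow>
     (let k = length (rhs r) in
        \<sigma> \<in> traces \<Phi> (funs r) \<and>
        q = (Par (lhs r) (\<sigma> ! 0) (\<sigma> ! (2 * k + 1)), decorate (rhs r) \<sigma> k))"

definition failing_rule ::
  "'p set \<Rightarrow> ('s, 'p) prule \<Rightarrow> nat \<Rightarrow> 'p list \<Rightarrow> ('s, 'p) irule \<Rightarrow> bool" where
  "failing_rule \<Phi> r h \<sigma> q \<longleftrightarrow>
     1 \<le> h \<and> h \<le> length (rhs r) \<and> \<sigma> \<in> traces \<Phi> (take h (funs r)) \<and>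
     (\<exists>\<beta> \<in> \<Phi>. \<exists>\<beta>h \<in> \<Phi>.
        (funs r ! h) (\<sigma> @ [\<beta>h]) = None \<and>
        q = (Par (lhs r) (\<sigma> ! 0) \<beta>, decorate (rhs r) (\<sigma> @ [\<beta>h]) h @ [Bot]))"

type_synonym ('s, 'p) pitem = "('s, 'p) prule \<times> nat \<times> nat \<times> nat \<times> 'p list"
type_synonym ('s, 'p) item = "('s, 'p) irule \<times> nat \<times> nat \<times> nat"

definition parameterized_items ::
  "'p set \<Rightarrow> ('s, 'p) prule set \<Rightarrow> 'c list \<Rightarrow> ('s, 'p) pitem set" where
  "parameterized_items \<Phi> \<RR> D =
     {(r, d, i, j, \<rho>). r \<in> \<RR> \<and> d \<le> length (rhs r) \<and> i \<le> j \<and> j \<le> length D \<and>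
        \<rho> \<in> traces \<Phi> (take (d + 1) (funs r))}"

text \<open>The item \<open>(L \<rightarrow> w\<^sub>1 \<bullet> w\<^sub>2, i, j)\<close>.\<close>

definition dotted ::
  "('s, 'p) isym \<Rightarrow> ('s, 'p) isym list \<Rightarrow> ('s, 'p) isym list \<Rightarrow> nat \<Rightarrow> nat \<Rightarrow> ('s, 'p) item" where
  "dotted L w1 w2 i j = ((L, w1 @ w2), length w1, i, j)"

text \<open>The set of ordinary items represented by the parameterized item \<open>x\<close>, i.e. \<open>x\<close> overlined.\<close>

definition items_of :: "'p set \<Rightarrow> ('s, 'p) pitem \<Rightarrow> ('s, 'p) item set" where
  "items_of \<Phi> x =
     (case x of (r, d, i, j, \<rho>) \<Rightarrow>
        {(q, d, i, j) | q \<sigma>. complete_rule \<Phi> r \<sigma> q \<and> take (2 * (d + 1)) \<sigma> = \<rho>} \<union>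
        {(q, d, i, j) | q h \<sigma>. failing_rule \<Phi> r h \<sigma> q \<and> d \<le> h - 1 \<and> take (2 * (d + 1)) \<sigma> = \<rho>})"

end

(* Run the rule from left to right, starting from the tuple rho and the subscript gamma. Whenever the
   next partial function is undefined, close the rule with Bot; otherwise append its value and an
   arbitrary next subscript. If no function is undefined, the result is a complete rule. *)

theory Submission imports Defs begin

lemma length_decorate [simp]: "length (decorate Xs \<sigma> n) = n"
  by (simp add: decorate_def)

lemma decorate_Suc:
  "decorate Xs \<sigma> (Suc n) = decorate Xs \<sigma> n @ [Par (Xs ! n) (\<sigma> ! (2 * n + 1)) (\<sigma> ! (2 * n + 2))]"
  by (simp add: decorate_def)

text \<open>The last entry that \<open>decorate\<close> reads is the subscript at index
  \<open>2 * n\<close>, hence the strict bound. A trace of length \<open>2 * n\<close> is one entry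
  short, so a subscript has to be appended before its last symbol can be decorated.\<close>

lemma decorate_append:
  assumes "2 * n < length \<sigma>"
  shows "decorate Xs (\<sigma> @ \<tau>) n = decorate Xs \<sigma> n"
  using assms by (auto simp: decorate_def nth_append)

text \<open>Subscripts are free and only the values of the functions are constrained, so a trace
  grows two entries at a time: the conditions for \<open>fs\<close> look only at
  \<open>\<sigma>\<close>, and the new one is exactly \<open>f\<close>.\<close>

lemma traces_snoc:
  assumes \<sigma>: "\<sigma> \<in> traces \<Phi> fs" and "\<beta> \<in> \<Phi>" "v \<in> \<Phi>" and f: "f (\<sigma> @ [\<beta>]) = Some v"
  shows "\<sigma> @ [\<beta>, v] \<in> traces \<Phi> (fs @ [f])"
proof -
  have len: "length \<sigma> = 2 * length fs" using \<sigma> by (simp add: traces_def)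
  have "((fs @ [f]) ! (i - 1)) (take (2 * i - 1) (\<sigma> @ [\<beta>, v])) = Some ((\<sigma> @ [\<beta>, v]) ! (2 * i - 1))"
    if i: "i \<in> {1..Suc (length fs)}" for i
  proof (cases "i = Suc (length fs)")
    case True
    with len f show ?thesis by (simp add: nth_append)
  next
    case False
    with i have "i \<in> {1..length fs}" by auto
    moreover from this \<sigma> have "(fs ! (i - 1)) (take (2 * i - 1) \<sigma>) = Some (\<sigma> ! (2 * i - 1))"
      by (simp add: traces_def)
    ultimately show ?thesis using len by (auto simp: nth_append)
  qed
  then show ?thesis using assms len by (simp add: traces_def)
qed

text \<open>The conclusion is shaped for \<open>items_of\<close>: \<open>\<sigma>'\<close> keeps
  \<open>\<sigma>\<close> as a prefix, and a failure can only occur at some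
  \<open>h' \<ge> h\<close>. Leaving \<open>w\<close> open lets each level of the induction move one
  symbol into it.\<close>

lemma trace_extends_to_rule:
  assumes r: "prule_over \<Phi> \<NN> \<TT> r"
    and "1 \<le> h" "h \<le> length (rhs r)" "\<sigma> \<in> traces \<Phi> (take h (funs r))" "\<gamma> \<in> \<Phi>"
  shows "\<exists>\<beta> \<in> \<Phi>. \<exists>w \<in> lists (induced_nonterminals \<Phi> \<NN> \<union> induced_terminals \<Phi> \<TT>). \<exists>q \<sigma>'.
    q = (Par (lhs r) (\<sigma> ! 0) \<beta>, decorate (rhs r) (\<sigma> @ [\<gamma>]) h @ w) \<and> take (2 * h) \<sigma>' = \<sigma> \<and>
    (complete_rule \<Phi> r \<sigma>' q \<or> (\<exists>h' \<ge> h. failing_rule \<Phi> r h' \<sigma>' q))"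
  using assms(2-)
\<comment> \<open>The measure counts the symbols still without a subscript beyond position
  \<open>h\<close>. \<open>\<gamma>\<close> stays fixed and serves as the subscript of every later
  symbol too.\<close>
proof (induction "length (rhs r) - h" arbitrary: h \<sigma> rule: less_induct)
  case less
  have len_funs: "length (funs r) = length (rhs r) + 1"
    using r by (simp add: prule_over_def)
  have len: "length \<sigma> = 2 * h" and \<sigma>: "set \<sigma> \<subseteq> \<Phi>"
    using less.prems len_funs by (auto simp: traces_def)
  show ?case
  proof (cases "(funs r ! h) (\<sigma> @ [\<gamma>])")
    case None
    \<comment> \<open>The left-hand subscript of a failing rule may be any element of
      \<open>\<Phi>\<close>; \<open>\<gamma>\<close> is at hand.\<close>
    have "failing_rule \<Phi> r h \<sigma> (Par (lhs r) (\<sigma> ! 0) \<gamma>, decorate (rhs r) (\<sigma> @ [\<gamma>]) h @ [Bot])"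
      using less.prems None by (auto simp: failing_rule_def)
    moreover have "[Bot] \<in> lists (induced_nonterminals \<Phi> \<NN> \<union> induced_terminals \<Phi> \<TT>)"
      by (simp add: induced_nonterminals_def)
    moreover have "take (2 * h) \<sigma> = \<sigma>" using len by simp
    ultimately show ?thesis using \<open>\<gamma> \<in> \<Phi>\<close> by blast
  next
    case (Some v)
    \<comment> \<open>The value \<open>v\<close> is the left-hand subscript if all symbols are used
      up, and otherwise the superscript of the next symbol.\<close>
    define \<sigma>1 where "\<sigma>1 = \<sigma> @ [\<gamma>, v]"
    have "Suc h \<in> {1..length (rhs r) + 1}" using less.prems by simp
    then have "partial_fun \<Phi> (2 * Suc h - 1) (funs r ! (Suc h - 1))"
      using r unfolding prule_over_def by blast
    then have v: "v \<in> \<Phi>" using Some by (auto simp: partial_fun_def ran_def)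
    have \<sigma>1: "\<sigma>1 \<in> traces \<Phi> (take (Suc h) (funs r))"
      using traces_snoc[where f = "funs r ! h", OF less.prems(3,4) v Some] less.prems len_funs
      by (simp add: \<sigma>1_def take_Suc_conv_app_nth)
    have hd: "\<sigma>1 ! 0 = \<sigma> ! 0" using less.prems len by (simp add: \<sigma>1_def nth_append)
    \<comment> \<open>Both tuples agree up to index \<open>2 * h\<close>. The complete rule needs
      \<open>\<tau> = []\<close>, the recursive case \<open>\<tau> = [\<gamma>]\<close>.\<close>
    have dec: "decorate (rhs r) (\<sigma>1 @ \<tau>) h = decorate (rhs r) (\<sigma> @ [\<gamma>]) h" for \<tau>
      using decorate_append[of h "\<sigma> @ [\<gamma>]" "rhs r" "v # \<tau>"] len by (simp add: \<sigma>1_def)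
    show ?thesis
    proof (cases "h = length (rhs r)")
      case True
      have "complete_rule \<Phi> r \<sigma>1 (Par (lhs r) (\<sigma> ! 0) v, decorate (rhs r) (\<sigma> @ [\<gamma>]) h @ [])"
        using \<sigma>1 True len_funs len hd dec[of "[]"]
        by (simp add: complete_rule_def \<sigma>1_def nth_append)
      moreover have "take (2 * h) \<sigma>1 = \<sigma>" using len by (simp add: \<sigma>1_def)
      ultimately show ?thesis using v by blast
    next
      case False
      let ?X = "Par (rhs r ! h) v \<gamma>"
      from False less.prems have h: "h < length (rhs r)" by simp
      then have "length (rhs r) - Suc h < length (rhs r) - h" "1 \<le> Suc h" "Suc h \<le> length (rhs r)"
        by simp_all
      from less.hyps[OF this \<sigma>1 \<open>\<gamma> \<in> \<Phi>\<close>]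
      obtain \<beta> w q \<sigma>' where IH: "\<beta> \<in> \<Phi>"
        "w \<in> lists (induced_nonterminals \<Phi> \<NN> \<union> induced_terminals \<Phi> \<TT>)"
        "q = (Par (lhs r) (\<sigma>1 ! 0) \<beta>, decorate (rhs r) (\<sigma>1 @ [\<gamma>]) (Suc h) @ w)"
        "take (2 * Suc h) \<sigma>' = \<sigma>1"
        "complete_rule \<Phi> r \<sigma>' q \<or> (\<exists>h' \<ge> Suc h. failing_rule \<Phi> r h' \<sigma>' q)"
        by blast
      \<comment> \<open>The last decorated symbol of the longer prefix is split off and becomes the
        head of the new remainder.\<close>
      have "q = (Par (lhs r) (\<sigma> ! 0) \<beta>, decorate (rhs r) (\<sigma> @ [\<gamma>]) h @ (?X # w))"
        using IH(3) dec[of "[\<gamma>]"] hd len by (simp add: decorate_Suc) (simp add: \<sigma>1_def nth_append)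
      moreover have "?X # w \<in> lists (induced_nonterminals \<Phi> \<NN> \<union> induced_terminals \<Phi> \<TT>)"
      proof -
        have "rhs r ! h \<in> \<NN> \<union> \<TT>" using r h nth_mem unfolding prule_over_def by blast
        with v \<open>\<gamma> \<in> \<Phi>\<close> IH(2) show ?thesis
          by (auto simp: induced_nonterminals_def induced_terminals_def)
      qed
      moreover have "take (2 * h) \<sigma>' = \<sigma>"
      proof -
        have "take (2 * h) \<sigma>' = take (2 * h) (take (2 * Suc h) \<sigma>')" by (simp add: min_def)
        with IH(4) len show ?thesis by (simp add: \<sigma>1_def)
      qed
      moreover have "complete_rule \<Phi> r \<sigma>' q \<or> (\<exists>h' \<ge> h. failing_rule \<Phi> r h' \<sigma>' q)"
        using IH(5) Suc_leD by blast
      ultimately show ?thesis using IH(1) by blast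
    qed
  qed
qed

theorem theorem4:
  fixes \<Phi> :: "'p set" and \<NN> \<TT> :: "'s set" and \<RR> :: "('s, 'p) prule set"
    and \<SS> :: 's and \<phi>start :: 'p and \<Sigma> :: "'c set" and D :: "'c list"
    and r :: "('s, 'p) prule" and d i j :: nat and \<rho> :: "'p list" and \<gamma> :: 'p
  assumes "parameterized_grammar \<Phi> \<NN> \<TT> \<RR> \<SS> \<phi>start"
    and "D \<in> lists \<Sigma>"
    and "(r, d, i, j, \<rho>) \<in> parameterized_items \<Phi> \<RR> D"
    and "length (rhs r) \<ge> d + 1"
    and "\<gamma> \<in> \<Phi>"
  shows "\<exists>\<beta> \<in> \<Phi>. \<exists>w \<in> lists (induced_nonterminals \<Phi> \<NN> \<union> induced_terminals \<Phi> \<TT>).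
    dotted (Par (lhs r) (\<rho> ! 0) \<beta>)
      (decorate (rhs r) \<rho> d) (Par (rhs r ! d) (\<rho> ! (2 * d + 1)) \<gamma> # w) i j
    \<in> items_of \<Phi> (r, d, i, j, \<rho>)"
proof -
  have r: "prule_over \<Phi> \<NN> \<TT> r" and \<rho>: "\<rho> \<in> traces \<Phi> (take (d + 1) (funs r))"
    using assms(1,3) by (auto simp: parameterized_grammar_def parameterized_items_def)
  have len: "length \<rho> = 2 * (d + 1)"
    using r \<rho> assms(4) by (simp add: traces_def prule_over_def)
  have "1 \<le> d + 1" by simp
  \<comment> \<open>Here \<open>h = d + 1\<close>: the item already fixes the superscript of the
    symbol after the dot, and \<open>\<gamma>\<close> supplies its subscript.\<close>
  from trace_extends_to_rule[OF r this assms(4) \<rho> assms(5)]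
  obtain \<beta> w q \<sigma> where q: "\<beta> \<in> \<Phi>"
    "w \<in> lists (induced_nonterminals \<Phi> \<NN> \<union> induced_terminals \<Phi> \<TT>)"
    "q = (Par (lhs r) (\<rho> ! 0) \<beta>, decorate (rhs r) (\<rho> @ [\<gamma>]) (d + 1) @ w)"
    "take (2 * (d + 1)) \<sigma> = \<rho>"
    "complete_rule \<Phi> r \<sigma> q \<or> (\<exists>h \<ge> d + 1. failing_rule \<Phi> r h \<sigma> q)"
    by blast
  have "dotted (Par (lhs r) (\<rho> ! 0) \<beta>)
      (decorate (rhs r) \<rho> d) (Par (rhs r ! d) (\<rho> ! (2 * d + 1)) \<gamma> # w) i j = (q, d, i, j)"
    using q(3) len by (simp add: dotted_def decorate_Suc decorate_append nth_append)
  moreover have "(q, d, i, j) \<in> items_of \<Phi> (r, d, i, j, \<rho>)"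
  proof -
    \<comment> \<open>This turns the bound on the failure position into the side condition on
      failing rules in \<open>items_of\<close>.\<close>
    have "d \<le> h - 1" if "d + 1 \<le> h" for h using that by simp
    with q(4,5) show ?thesis unfolding items_of_def by blast
  qed
  ultimately show ?thesis using q(1,2) by (metis (no_types, lifting))
qed

end
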